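(* Let $X=\{1,\ldots,K\}$, let $Y$ be a finite set, and let $h:D\to Y$. Suppose that for every $y\in Y$ the level set $L(y)=\{p\in D: h(p)=y\}$ is a finite union of sets, each of which is a finite intersection of sets of the form $\{p\in D:\alpha_1p_1+\cdots+\alpha_Kp_K\le\alpha\}$ or $\{p\in D:\alpha_1p_1+\cdots+\alpha_Kp_K<\alpha\}$ with rational coefficients $\alpha,\alpha_1,\ldots,\alpha_K$. Then $h$ is computable.
   Context: Model of computation. Let $X$ (initial values), $Y$ (outputs), $M$ (messages) be sets and, for each integer $d\ge 0$, let $Z_d$ be a set (memory states); each of $Y$, $M$, $Z_d$ contains a distinguished element $\emptyset$. An automaton family is a sequence of maps $(A_d)_{d\ge0}$, $A_d: X\times Z_d\times Y\times M^d\to X\times Z_d\times Y\times M^d$, which leave the first coordinate unchanged. A network is a finite connected simple undirected graph $G=(V,E)$ with $V=\{1,\ldots,n\}$, together with a port labeling: for each node $i$ of degree $d(i)$, a bijection $\ell_i$ from the set of neighbors of $i$ to $\{1,\ldots,d(i)\}$. Given initial values $x_1,\ldots,x_n\in X$, the execution is: node $i$ has state $S_i(t)=(x_i,z_i(t),y_i(t),m_{i,1}(t),\ldots,m_{i,d(i)}(t))$ with $z_i(0)=y_i(0)=m_{i,k}(0)=\emptyset$ ($m_{i,p}(t)$ is the message $i$ sends through its port $p$), and $S_i(t+1)=A_{d(i)}(x_i,z_i(t),y_i(t),\mu_{i,1}(t),\ldots,\mu_{i,d(i)}(t))$, where if $j$ is the neighbor of $i$ with $\ell_i(j)=k$ then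 $\mu_{i,k}(t)=m_{j,\ell_j(i)}(t)$. An element $y^*\in Y$ is the final output of the execution if there is $t'$ with $y_i(t)=y^*$ for all nodes $i$ and all $t\ge t'$. Finite memory: $X,Y,M$ and all $Z_d$ are finite and $\log|Z_d|\le Cd$ for all $d\ge1$, for a constant $C$ independent of $d$. A family of functions $(f_n:X^n\to Y)_{n\ge1}$ is computable if there exists an automaton family with finite memory such that for every $n$, every network with $n$ nodes (every connected graph and every port labeling), and every $x\in X^n$, the execution has a final output equal to $f_n(x_1,\ldots,x_n)$. Proportions. For $X=\{1,\ldots,K\}$ and $x\in X^n$, $p_k(x)=|\{i: x_i=k\}|/n$. The proportion set is $D=\{(p_1,\ldots,p_K)\in[0,1]^K:\sum_k p_k=1\}$. A function $h:D\to Y$ is computable if the family $f_n(x)=h(p_1(x),\ldots,p_K(x))$, $x\in X^n$, is computable. *)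

theory Defs
  imports Complex_Main
begin

(* Nodes of a network with n nodes are 0,...,n-1 (instead of 1,...,n).
   E is the (symmetric, irreflexive) adjacency relation, only its restriction
   to {..<n} matters; l i is the port labelling of node i. *)

definition deg :: "nat \<Rightarrow> (nat \<Rightarrow> nat \<Rightarrow> bool) \<Rightarrow> nat \<Rightarrow> nat" where
  "deg n E i = card {j. j < n \<and> E i j}"

definition network :: "nat \<Rightarrow> (nat \<Rightarrow> nat \<Rightarrow> bool) \<Rightarrow> (nat \<Rightarrow> nat \<Rightarrow> nat) \<Rightarrow> bool" where
  "network n E l \<longleftrightarrow> n \<ge> 1
     \<and> (\<forall>i<n. \<forall>j<n. E i j \<longrightarrow> E j i)
     \<and> (\<forall>i<n. \<not> E i i)
     \<and> (\<forall>i<n. \<forall>j<n. (\<lambda>a b. a < n \<and> b < n \<and> E a b)\<^sup>*\<^sup>* i j)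
     \<and> (\<forall>i<n. bij_betw (l i) {j. j < n \<and> E i j} {1..deg n E i})"

(* An automaton family: A d x z y \<mu> = (z', y', m'), for the node degree d,
   initial value x, memory z, output y, incoming messages \<mu> (port k = 1..d),
   returning new memory, output and outgoing messages (port p = 1..d).
   The initial value coordinate is left unchanged, so it is not returned.
   Memory states and messages are encoded as natural numbers, with 0 playing
   the role of the distinguished element; outputs are 'y option with None
   the distinguished element. *)
type_synonym 'y automaton =
  "nat \<Rightarrow> nat \<Rightarrow> nat \<Rightarrow> 'y option \<Rightarrow> (nat \<Rightarrow> nat) \<Rightarrow> nat \<times> 'y option \<times> (nat \<Rightarrow> nat)"

definition nbr :: "nat \<Rightarrow> (nat \<Rightarrow> nat \<Rightarrow> bool) \<Rightarrow> (nat \<Rightarrow> nat \<Rightarrow> nat) \<Rightarrow> nat \<Rightarrow> nat \<Rightarrow> nat" where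
  "nbr n E l i k = (THE j. j < n \<and> E i j \<and> l i j = k)"

primrec run :: "'y automaton \<Rightarrow> nat \<Rightarrow> (nat \<Rightarrow> nat \<Rightarrow> bool) \<Rightarrow> (nat \<Rightarrow> nat \<Rightarrow> nat)
    \<Rightarrow> (nat \<Rightarrow> nat) \<Rightarrow> nat \<Rightarrow> nat \<Rightarrow> nat \<times> 'y option \<times> (nat \<Rightarrow> nat)" where
  "run A n E l x 0 = (\<lambda>i. (0, None, \<lambda>_. 0))"
| "run A n E l x (Suc t) = (\<lambda>i.
     A (deg n E i) (x i) (fst (run A n E l x t i)) (fst (snd (run A n E l x t i)))
       (\<lambda>k. if 1 \<le> k \<and> k \<le> deg n E i
            then snd (snd (run A n E l x t (nbr n E l i k))) (l (nbr n E l i k) i)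
            else 0))"

definition final_output :: "'y automaton \<Rightarrow> nat \<Rightarrow> (nat \<Rightarrow> nat \<Rightarrow> bool) \<Rightarrow> (nat \<Rightarrow> nat \<Rightarrow> nat)
    \<Rightarrow> (nat \<Rightarrow> nat) \<Rightarrow> 'y option \<Rightarrow> bool" where
  "final_output A n E l x y \<longleftrightarrow>
     (\<exists>t'. \<forall>t\<ge>t'. \<forall>i<n. fst (snd (run A n E l x t i)) = y)"

definition finite_memory :: "nat \<Rightarrow> 'y automaton \<Rightarrow> nat set \<Rightarrow> (nat \<Rightarrow> nat set) \<Rightarrow> bool" where
  "finite_memory K A Ms Zs \<longleftrightarrow>
     finite (UNIV :: 'y option set)
     \<and> finite Ms \<and> 0 \<in> Ms
     \<and> (\<forall>d. finite (Zs d) \<and> 0 \<in> Zs d)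
     \<and> (\<exists>C::real. \<forall>d\<ge>1. log 2 (card (Zs d)) \<le> C * d)
     \<and> (\<forall>d x z y \<mu>. x \<in> {1..K} \<and> z \<in> Zs d \<and> (\<forall>k\<in>{1..d}. \<mu> k \<in> Ms) \<longrightarrow>
          fst (A d x z y \<mu>) \<in> Zs d \<and> (\<forall>p\<in>{1..d}. snd (snd (A d x z y \<mu>)) p \<in> Ms))"

(* f n x is f_n(x_0,...,x_{n-1}) *)
definition computable_family :: "nat \<Rightarrow> (nat \<Rightarrow> (nat \<Rightarrow> nat) \<Rightarrow> 'y) \<Rightarrow> bool" where
  "computable_family K f \<longleftrightarrow>
     (\<exists>(A :: 'y automaton) Ms Zs. finite_memory K A Ms Zs \<and>
        (\<forall>n E l x. network n E l \<and> (\<forall>i<n. x i \<in> {1..K}) \<longrightarrow>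
           final_output A n E l x (Some (f n x))))"

definition prop_set :: "nat \<Rightarrow> (nat \<Rightarrow> real) set" where
  "prop_set K = {p. (\<forall>k\<in>{1..K}. 0 \<le> p k \<and> p k \<le> 1) \<and> (\<Sum>k=1..K. p k) = 1
                    \<and> (\<forall>k. k \<notin> {1..K} \<longrightarrow> p k = 0)}"

definition proportions :: "nat \<Rightarrow> (nat \<Rightarrow> nat) \<Rightarrow> nat \<Rightarrow> real" where
  "proportions n x = (\<lambda>k. real (card {i. i < n \<and> x i = k}) / real n)"

definition computable_prop :: "nat \<Rightarrow> ((nat \<Rightarrow> real) \<Rightarrow> 'y) \<Rightarrow> bool" where
  "computable_prop K h \<longleftrightarrow> computable_family K (\<lambda>n x. h (proportions n x))"

definition halfspace :: "nat \<Rightarrow> (nat \<Rightarrow> rat) \<times> rat \<times> bool \<Rightarrow> (nat \<Rightarrow> real) set" where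
  "halfspace K c = (case c of (\<alpha>, b, strict) \<Rightarrow>
     {p \<in> prop_set K. if strict then (\<Sum>k=1..K. of_rat (\<alpha> k) * p k) < of_rat b
                                else (\<Sum>k=1..K. of_rat (\<alpha> k) * p k) \<le> of_rat b})"

end

theory Submission
  imports Defs "HOL-Library.Nat_Bijection"
begin

text \<open>
Membership in a rational halfspace is the sign condition \<open>\<Sum>i. v (x i) < 0\<close> for an integer weight \<open>v\<close>,
or the negation of such a condition, so finitely many sign conditions determine \<open>h\<close>; they are decided
in parallel.

For one weight, a node with \<open>v (x i) > 0\<close> emits that many tokens, and a node with \<open>v (x i) < 0\<close>
can absorb \<open>-v (x i)\<close> tokens. Each node forwards the tokens that it does not absorb to its ports in
round-robin order, so at most \<open>W\<close> tokens ever use an edge at once, and tokens that survive forever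
visit every node infinitely often. Hence eventually some node keeps unused capacity forever if the
sum is negative, and no node has unused capacity otherwise.

To tell these cases apart everywhere, every node has a clock: it ticks unless the node has unused
capacity or a neighbour's clock is behind. Neighbouring clocks then always differ by at most 1, so
their values modulo 3 suffice to compare them. A node with unused capacity forever stops all clocks;
without such nodes all clocks eventually tick at every step.
\<close>

section \<open>Networks\<close>

locale net =
  fixes n :: nat and E :: "nat \<Rightarrow> nat \<Rightarrow> bool" and l :: "nat \<Rightarrow> nat \<Rightarrow> nat"
  assumes network: "network n E l"
begin

abbreviation "dg \<equiv> deg n E"
abbreviation "nb \<equiv> nbr n E l"

lemma n_pos: "0 < n"
  using network by (auto simp: network_def)

lemma E_sym: "i < n \<Longrightarrow> j < n \<Longrightarrow> E i j \<Longrightarrow> E j i"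
  using network by (auto simp: network_def)

lemma l_bij: "i < n \<Longrightarrow> bij_betw (l i) {j. j < n \<and> E i j} {1..dg i}"
  using network by (auto simp: network_def)

lemma nbr_l:
  assumes "i < n" "j < n" "E i j"
  shows "l i j \<in> {1..dg i}" "nb i (l i j) = j"
proof -
  have b: "bij_betw (l i) {j. j < n \<and> E i j} {1..dg i}" using assms l_bij by blast
  show "l i j \<in> {1..dg i}"
    by (rule bij_betw_apply[OF b]) (use assms in simp)
  show "nb i (l i j) = j"
    unfolding nbr_def
  proof (rule the_equality)
    fix j' assume "j' < n \<and> E i j' \<and> l i j' = l i j"
    then show "j' = j"
      using bij_betw_imp_inj_on[OF b] assms unfolding inj_on_def by blast
  qed (use assms in simp)
qed

lemma nbr_port:
  assumes "i < n" "k \<in> {1..dg i}"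
  shows "nb i k < n" "E i (nb i k)" "l i (nb i k) = k"
proof -
  have "k \<in> l i ` {j. j < n \<and> E i j}"
    using bij_betw_imp_surj_on[OF l_bij[OF assms(1)]] assms(2) by simp
  then obtain j where j: "j < n" "E i j" "k = l i j" by auto
  then show "nb i k < n" "E i (nb i k)" "l i (nb i k) = k"
    using nbr_l(2)[OF assms(1) j(1,2)] by auto
qed

lemma nbr_back:
  assumes "i < n" "k \<in> {1..dg i}"
  shows "l (nb i k) i \<in> {1..dg (nb i k)}" "nb (nb i k) (l (nb i k) i) = i"
  using nbr_port[OF assms] nbr_l[of "nb i k" i] E_sym[of i "nb i k"] assms(1) by auto

text \<open>Crossing an edge to its other end is an involution on pairs of node and port, so
  receivers read what senders wrote, in another order.\<close>

lemma sum_incoming: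
  "(\<Sum>i<n. \<Sum>k=1..dg i. g (nb i k) (l (nb i k) i)) = (\<Sum>i<n. \<Sum>k=1..dg i. g i k)"
proof -
  let ?A = "Sigma {..<n} (\<lambda>i. {1..dg i})"
  let ?s = "\<lambda>(i, k). (nb i k, l (nb i k) i)"
  have "(\<Sum>(i, k)\<in>?A. g (nb i k) (l (nb i k) i)) = (\<Sum>(i, k)\<in>?A. g i k)"
    by (rule sum.reindex_bij_witness[where i = ?s and j = ?s])
      (use nbr_port nbr_back in \<open>auto\<close>)
  then show ?thesis by (simp add: sum.Sigma)
qed

lemma connected_induct:
  assumes "i < n" "j < n" "P i"
    and step: "\<And>a b. a < n \<Longrightarrow> b < n \<Longrightarrow> E a b \<Longrightarrow> P a \<Longrightarrow> P b"
  shows "P j"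
proof -
  have "(\<lambda>a b. a < n \<and> b < n \<and> E a b)\<^sup>*\<^sup>* i j"
    using network assms(1,2) by (auto simp: network_def)
  then show ?thesis
    by (induction rule: rtranclp_induct) (use assms in auto)
qed

text \<open>Conservation of tokens rests on this: a node without ports, as in the one-node network,
  loses the tokens that it does not absorb.\<close>

lemma deg_pos:
  assumes "i < n" "n \<noteq> 1"
  shows "0 < dg i"
proof -
  obtain j where j: "j < n" "j \<noteq> i"
    by (cases "i = 0") (use assms n_pos in \<open>auto intro: that[of 0] that[of 1]\<close>)
  have "(\<lambda>a b. a < n \<and> b < n \<and> E a b)\<^sup>*\<^sup>* i j"
    using network assms(1) j by (auto simp: network_def)
  then obtain k where "k < n" "E i k"
    using j(2) by (auto elim: converse_rtranclpE)
  then have "k \<in> {j. j < n \<and> E i j}" by simp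
  then show ?thesis unfolding deg_def by (auto simp: card_gt_0_iff)
qed

end

section \<open>Token walks\<close>

text \<open>Token \<open>j\<close> of a batch of \<open>s\<close> leaves through port
  \<open>(r + j) mod d + 1\<close>; ports are numbered from 1, the rotor counts from 0.\<close>

definition round_robin :: "nat \<Rightarrow> nat \<Rightarrow> nat \<Rightarrow> nat \<Rightarrow> nat" where
  "round_robin d r s p = card {j. j < s \<and> (r + j) mod d = p - 1}"

text \<open>Tokens of one port have indices congruent modulo \<open>d\<close>, hence distinct
  quotients by \<open>d\<close>, all below \<open>W\<close>.\<close>

lemma round_robin_le:
  assumes "0 < d" "s \<le> d * W"
  shows "round_robin d r s p \<le> W"
proof -
  let ?S = "{j. j < s \<and> (r + j) mod d = p - 1}"
  have "inj_on (\<lambda>j. j div d) ?S"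
  proof (rule inj_onI)
    fix a b assume ab: "a \<in> ?S" "b \<in> ?S" "a div d = b div d"
    then have "(r + a) mod d = (r + b) mod d" by simp
    then have "a mod d = b mod d"
      by (auto simp: nat_mod_eq_iff)
    then show "a = b" using ab(3) by (metis div_mult_mod_eq)
  qed
  moreover have "(\<lambda>j. j div d) ` ?S \<subseteq> {..<W}"
    using assms by (auto simp: less_mult_imp_div_less mult.commute order_less_le_trans)
  ultimately have "card ?S \<le> card {..<W}"
    by (rule card_inj_on_le) simp
  then show ?thesis by (simp add: round_robin_def)
qed

lemma sum_round_robin:
  assumes "0 < d"
  shows "(\<Sum>p=1..d. round_robin d r s p) = s"
proof -
  have "(\<Sum>p=1..d. round_robin d r s p) = (\<Sum>p\<in>{..<d}. card {j \<in> {..<s}. (r + j) mod d = p})"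
    by (rule sum.reindex_bij_witness[where i = Suc and j = "\<lambda>p. p - 1"])
      (auto simp: round_robin_def)
  also have "\<dots> = card {..<s}"
    using sum.group[of "{..<s}" "{..<d}" "\<lambda>j. (r + j) mod d" "\<lambda>_. 1::nat"] assms
    by (auto simp: image_subset_iff)
  finally show ?thesis by simp
qed

lemma eventually_stationary_nat:
  fixes f :: "nat \<Rightarrow> nat"
  assumes "\<And>t. f t \<le> f (Suc t)" "\<And>t. f t \<le> B"
  shows "\<exists>T. \<forall>t\<ge>T. f (Suc t) = f t"
proof -
  have mono: "s \<le> t \<Longrightarrow> f s \<le> f t" for s t
    using assms(1) by (simp add: lift_Suc_mono_le)
  have fin: "finite (range f)"
    by (rule finite_subset[of _ "{..B}"]) (use assms(2) in auto)
  then have "Max (range f) \<in> range f" by (intro Max_in) auto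
  then obtain T where T: "f T = Max (range f)" by (metis imageE)
  have "f (Suc t) = f t" if "t \<ge> T" for t
    using mono[OF that] mono[of t "Suc t"] Max_ge[OF fin, of "f (Suc t)"] T by auto
  then show ?thesis by blast
qed

lemma eventually_all_less:
  fixes n :: nat
  assumes "\<And>i. i < n \<Longrightarrow> \<exists>T::nat. \<forall>t\<ge>T. P i t"
  shows "\<exists>T. \<forall>t\<ge>T. \<forall>i<n. P i t"
proof -
  have "\<forall>\<^sub>F t in sequentially. \<forall>i\<in>{..<n}. P i t"
    using assms by (intro eventually_ball_finite) (auto simp: eventually_sequentially)
  then show ?thesis by (auto simp: eventually_sequentially)
qed

text \<open>Everything is a function of time: in step \<open>t\<close>, node \<open>i\<close>
  receives \<open>inn t i\<close> tokens and forwards \<open>out t i\<close>; before it,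
  \<open>c t i\<close> are absorbed and the rotor is \<open>r t i\<close>. Emitted tokens enter
  through \<open>inn\<close> at time 0.\<close>

locale token_walk = net +
  fixes wp wn :: "nat \<Rightarrow> nat" and W :: nat
    and c r inn out :: "nat \<Rightarrow> nat \<Rightarrow> nat" and tok :: "nat \<Rightarrow> nat \<Rightarrow> nat \<Rightarrow> nat"
  assumes wp_le: "\<And>i. i < n \<Longrightarrow> wp i \<le> W"
    and inn_eq: "\<And>t i. i < n \<Longrightarrow> inn t i =
      (\<Sum>k=1..dg i. tok t (nb i k) (l (nb i k) i)) + (if t = 0 then wp i else 0)"
    and out_eq: "\<And>t i. out t i = inn t i - min (inn t i) (wn i - c t i)"
    and c_0: "\<And>i. c 0 i = 0"
    and c_Suc: "\<And>t i. i < n \<Longrightarrow> c (Suc t) i = c t i + min (inn t i) (wn i - c t i)"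
    and r_0: "\<And>i. r 0 i = 0"
    and r_Suc: "\<And>t i. i < n \<Longrightarrow> dg i > 0 \<Longrightarrow> r (Suc t) i = (r t i + out t i) mod dg i"
    and tok_0: "\<And>i p. tok 0 i p = 0"
    and tok_Suc: "\<And>t i p. i < n \<Longrightarrow> p \<in> {1..dg i} \<Longrightarrow>
      tok (Suc t) i p = min W (round_robin (dg i) (r t i) (out t i) p)"
begin

lemma c_le: "i < n \<Longrightarrow> c t i \<le> wn i"
  by (induction t) (auto simp: c_0 c_Suc)

lemma tok_le: "i < n \<Longrightarrow> p \<in> {1..dg i} \<Longrightarrow> tok t i p \<le> W"
  by (cases t) (auto simp: tok_0 tok_Suc)

lemma inn_le:
  assumes "i < n" "dg i > 0"
  shows "inn t i \<le> dg i * W"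
proof (cases "t = 0")
  case True
  have "W \<le> dg i * W" using assms(2) by simp
  then have "wp i \<le> dg i * W" using wp_le[OF assms(1)] by (rule order_trans[rotated])
  then show ?thesis using True by (simp add: inn_eq assms tok_0)
next
  case False
  have "(\<Sum>k=1..dg i. tok t (nb i k) (l (nb i k) i)) \<le> (\<Sum>k=1..dg i. W)"
    by (intro sum_mono tok_le nbr_port nbr_back assms)
  then show ?thesis using False by (simp add: inn_eq assms)
qed

text \<open>The cut at \<open>W\<close> is vacuous, without circularity: being imposed on every
  message, it limits a batch to \<open>dg i * W\<close> tokens, and round robin then sends at most
  \<open>W\<close> of these to each port.\<close>

lemma tok_Suc':
  assumes "i < n" "p \<in> {1..dg i}"
  shows "tok (Suc t) i p = round_robin (dg i) (r t i) (out t i) p"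
proof -
  have d: "dg i > 0" using assms(2) by auto
  have "out t i \<le> dg i * W" using inn_le[OF assms(1) d, of t] by (simp add: out_eq)
  then show ?thesis using round_robin_le[OF d] assms by (simp add: tok_Suc min_absorb2)
qed

section \<open>Conservation of tokens\<close>

definition "transit t = (\<Sum>i<n. \<Sum>p=1..dg i. tok t i p)"
definition "cancelled t = (\<Sum>i<n. c t i)"

lemma sum_inn: "(\<Sum>i<n. inn t i) = transit t + (if t = 0 then \<Sum>i<n. wp i else 0)"
  using sum_incoming[of "tok t"] by (simp add: inn_eq sum.distrib transit_def)

lemma inn_split: "i < n \<Longrightarrow> inn t i + c t i = out t i + c (Suc t) i"
  by (auto simp: out_eq c_Suc)

lemma sum_sent:
  assumes "i < n"
  shows "(\<Sum>p=1..dg i. tok (Suc t) i p) \<le> out t i"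
    and "dg i > 0 \<Longrightarrow> (\<Sum>p=1..dg i. tok (Suc t) i p) = out t i"
proof -
  have eq: "(\<Sum>p=1..dg i. tok (Suc t) i p) = (\<Sum>p=1..dg i. round_robin (dg i) (r t i) (out t i) p)"
    by (intro sum.cong) (use tok_Suc' assms in auto)
  show *: "dg i > 0 \<Longrightarrow> (\<Sum>p=1..dg i. tok (Suc t) i p) = out t i"
    unfolding eq by (rule sum_round_robin)
  show "(\<Sum>p=1..dg i. tok (Suc t) i p) \<le> out t i"
    using * by (cases "dg i = 0") auto
qed

lemma balance_step_le:
  "transit (Suc t) + cancelled (Suc t) \<le> (\<Sum>i<n. inn t i) + cancelled t"
  unfolding transit_def cancelled_def sum.distrib[symmetric]
proof (rule sum_mono)
  fix i assume "i \<in> {..<n}"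
  then show "(\<Sum>p=1..dg i. tok (Suc t) i p) + c (Suc t) i \<le> inn t i + c t i"
    using sum_sent(1)[of i t] inn_split[of i t] by simp
qed

lemma balance_step:
  assumes "n \<noteq> 1"
  shows "transit (Suc t) + cancelled (Suc t) = (\<Sum>i<n. inn t i) + cancelled t"
  unfolding transit_def cancelled_def sum.distrib[symmetric]
proof (rule sum.cong[OF refl])
  fix i assume "i \<in> {..<n}"
  then show "(\<Sum>p=1..dg i. tok (Suc t) i p) + c (Suc t) i = inn t i + c t i"
    using sum_sent(2)[of i t] inn_split[of i t] deg_pos[OF _ assms, of i] by simp
qed

lemma transit_0: "transit 0 = 0" and cancelled_0: "cancelled 0 = 0"
  by (simp_all add: transit_def cancelled_def tok_0 c_0)

text \<open>An inequality, so as to include the one-node network, where tokens may get lost.\<close>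

lemma balance_le: "transit t + cancelled t \<le> (\<Sum>i<n. wp i)"
proof (induction t)
  case (Suc t)
  then show ?case using balance_step_le[of t]
    by (cases t) (auto simp: sum_inn transit_0 cancelled_0)
qed (simp add: transit_0 cancelled_0)

text \<open>From time 1 on, since the emitted tokens are not yet in transit at time 0.\<close>

lemma balance:
  assumes "n \<noteq> 1"
  shows "transit (Suc t) + cancelled (Suc t) = (\<Sum>i<n. wp i)"
proof (induction t)
  case 0
  show ?case using balance_step[OF assms, of 0] by (simp add: sum_inn transit_0 cancelled_0)
next
  case (Suc t)
  then show ?case using balance_step[OF assms, of "Suc t"] by (simp add: sum_inn)
qed

text \<open>Absorbed tokens never outnumber the emitted ones, so the total capacity is never
  exhausted.\<close>

lemma source_persists:
  assumes "(\<Sum>i<n. wp i) < (\<Sum>i<n. wn i)"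
  shows "\<exists>i<n. c t i < wn i"
proof (rule ccontr)
  assume "\<not> ?thesis"
  then have "(\<Sum>i<n. wn i) \<le> cancelled t"
    unfolding cancelled_def by (intro sum_mono) (metis lessThan_iff not_less)
  then show False using assms balance_le[of t] by simp
qed

text \<open>The rotor is the number of tokens forwarded so far modulo the degree; as this number
  grows without bound, each port is served again and again.\<close>

lemma visit_propagates:
  assumes ij: "i < n" "j < n" "E i j"
    and inf: "\<forall>t0. \<exists>t\<ge>t0. 0 < out t i"
  shows "\<forall>t0. \<exists>t\<ge>t0. 0 < inn t j"
proof
  fix t0
  define d where "d = dg i"
  define p where "p = l i j"
  have p: "p \<in> {1..d}" "nb i p = j" using nbr_l[OF ij] by (auto simp: d_def p_def)
  then have d: "0 < d" by auto
  define F where "F t = (\<Sum>s<t. out s i)" for t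
  have F_mono: "s \<le> t \<Longrightarrow> F s \<le> F t" for s t
    unfolding F_def by (intro sum_mono2) auto
  have r: "r t i = F t mod d" for t
  proof (induction t)
    case (Suc t)
    then show ?case using r_Suc[of i t] ij d by (simp add: F_def d_def mod_add_left_eq)
  qed (simp add: F_def r_0)
  have unbounded: "\<exists>t. B \<le> F t" for B
  proof (induction B)
    case (Suc B)
    then obtain t where t: "B \<le> F t" by auto
    obtain s where s: "s \<ge> t" "0 < out s i" using inf by auto
    have "Suc B \<le> F (Suc s)" using F_mono[OF s(1)] s(2) t by (simp add: F_def)
    then show ?case by blast
  qed auto
  \<comment> \<open>Number the tokens forwarded by \<open>i\<close> consecutively from 0. Token
    \<open>s\<close> uses port \<open>p\<close> and, as \<open>d * F t0\<close> is at least
    \<open>F t0\<close>, is not among those forwarded before \<open>t0\<close>.\<close>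
  define s where "s = p - 1 + d * F t0"
  have sF: "F t0 \<le> s" using d by (simp add: s_def trans_le_add2)
  have smod: "s mod d = p - 1" unfolding s_def mod_mult_self2 using p(1) by (intro mod_less) auto
  have ex: "\<exists>t. s < F t" using unbounded[of "Suc s"] by (auto simp: Suc_le_eq)
  \<comment> \<open>Token \<open>s\<close> leaves in step \<open>T - 1\<close>, the first after
    which more than \<open>s\<close> tokens have been forwarded; \<open>k\<close> below is its index
    in that batch.\<close>
  define T where "T = (LEAST t. s < F t)"
  have T: "s < F T" using LeastI_ex[OF ex] by (simp add: T_def)
  have "T \<noteq> 0" using T by (auto simp: F_def intro: ccontr)
  then obtain t where t: "T = Suc t" by (cases T) auto
  have Ft: "F t \<le> s" using not_less_Least[of t "\<lambda>t. s < F t"] t by (auto simp: T_def not_less)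
  have "t0 \<le> t"
  proof (rule ccontr)
    assume "\<not> t0 \<le> t"
    then have "F T \<le> F t0" by (intro F_mono) (use t in simp)
    then show False using T sF by simp
  qed
  define k where "k = s - F t"
  have k: "k < out t i" using T Ft by (simp add: k_def t F_def)
  have "(r t i + k) mod d = p - 1" using smod Ft
    by (simp only: r mod_add_left_eq k_def le_add_diff_inverse)
  then have "k \<in> {j. j < out t i \<and> (r t i + j) mod d = p - 1}" using k by simp
  then have "0 < round_robin d (r t i) (out t i) p"
    unfolding round_robin_def by (auto simp: card_gt_0_iff)
  then have tok: "0 < tok (Suc t) i p" using tok_Suc'[OF ij(1), of p t] p by (simp add: d_def)
  have ji: "E j i" using E_sym ij by blast
  define q where "q = l j i"
  have q: "q \<in> {1..dg j}" "nb j q = i" using nbr_l[OF ij(2,1) ji] by (auto simp: q_def)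
  have "tok (Suc t) (nb j q) (l (nb j q) j) \<le> (\<Sum>k=1..dg j. tok (Suc t) (nb j k) (l (nb j k) j))"
    by (rule member_le_sum) (use q in auto)
  then have "0 < inn (Suc t) j" using tok q by (simp add: inn_eq ij p_def)
  then show "\<exists>t\<ge>t0. 0 < inn t j" using \<open>t0 \<le> t\<close> by (intro exI[of _ "Suc t"]) auto
qed

lemma c_eventually_stationary: "\<exists>T. \<forall>t\<ge>T. \<forall>i<n. c (Suc t) i = c t i"
proof (rule eventually_all_less)
  fix i assume "i < n"
  then show "\<exists>T. \<forall>t\<ge>T. c (Suc t) i = c t i"
    by (intro eventually_stationary_nat[of "\<lambda>t. c t i" "wn i"]) (use c_le c_Suc in auto)
qed

text \<open>Absorption stops eventually. If capacity were left, tokens would stay in transit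
  forever; some node would receive tokens infinitely often, and by \<open>visit_propagates\<close>
  and connectedness so would the node with spare capacity, which would absorb.\<close>

lemma sources_vanish:
  assumes le: "(\<Sum>i<n. wn i) \<le> (\<Sum>i<n. wp i)" and disj: "\<And>i. i < n \<Longrightarrow> wp i = 0 \<or> wn i = 0"
  shows "\<exists>T. \<forall>t\<ge>T. \<forall>i<n. c t i = wn i"
proof (cases "n = 1")
  case True
  \<comment> \<open>The single node cannot both emit and absorb, so \<open>le\<close> leaves it no
    capacity.\<close>
  then have "wn 0 = 0" using le disj[of 0] by auto
  then show ?thesis using True c_le[of 0] by auto
next
  case False
  obtain T0 where T0: "\<forall>t\<ge>T0. \<forall>i<n. c (Suc t) i = c t i"
    using c_eventually_stationary by blast
  \<comment> \<open>The successor makes \<open>T\<close> positive, since \<open>balance\<close>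
    starts at time 1.\<close>
  define T where "T = Suc T0"
  have T: "c t i = c T i" if "t \<ge> T" "i < n" for t i
    using that(1) by (induction t rule: dec_induct) (use T0 that(2) in \<open>auto simp: T_def\<close>)
  have no_cancel: "min (inn t i) (wn i - c t i) = 0" if "t \<ge> T" "i < n" for t i
    using c_Suc[OF that(2), of t] T0 that by (simp add: T_def)
  have "c T i = wn i" if i: "i < n" for i
  proof (rule ccontr)
    assume neq: "c T i \<noteq> wn i"
    then have lt: "c T i < wn i" using c_le[OF i, of T] by simp
    have "cancelled t < (\<Sum>i<n. wp i)" if "t \<ge> T" for t
    proof -
      have "cancelled t < (\<Sum>i<n. wn i)" unfolding cancelled_def
        using c_le lt T[OF that i] i by (intro sum_strict_mono_ex1 bexI[of _ i]) auto
      then show ?thesis using le by simp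
    qed
    moreover have "transit t + cancelled t = (\<Sum>i<n. wp i)" if "t \<ge> T" for t
      using balance[OF False, of "t - 1"] that by (cases t) (auto simp: T_def)
    ultimately have tr: "0 < transit t" if "t \<ge> T" for t
      using that by force
    have some: "\<exists>j\<in>{..<n}. 0 < inn t j" if "t \<ge> T" for t
    proof (rule ccontr)
      assume "\<not> ?thesis"
      then have "(\<Sum>j<n. inn t j) = 0" by simp
      then show False using tr[OF that] sum_inn[of t] by simp
    qed
    have "\<exists>j<n. \<forall>t0. \<exists>t\<ge>t0. 0 < inn t j"
    proof (rule ccontr)
      assume neg: "\<not> ?thesis"
      have "\<exists>t0. \<forall>t\<ge>t0. inn t j = 0" if "j < n" for j
        using neg that by (metis gr0I)
      then obtain t0 where t0: "\<forall>t\<ge>t0. \<forall>j<n. inn t j = 0"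
        using eventually_all_less[of n "\<lambda>j t. inn t j = 0"] by blast
      show False using some[of "max T t0"] t0 by auto
    qed
    then obtain j where j: "j < n" "\<forall>t0. \<exists>t\<ge>t0. 0 < inn t j" by blast
    have "\<forall>t0. \<exists>t\<ge>t0. 0 < inn t i"
    proof (rule connected_induct[where P = "\<lambda>a. \<forall>t0. \<exists>t\<ge>t0. 0 < inn t a", OF j(1) i j(2)])
      fix a b assume ab: "a < n" "b < n" "E a b" "\<forall>t0. \<exists>t\<ge>t0. 0 < inn t a"
      \<comment> \<open>Nothing is absorbed from \<open>T\<close> on, so \<open>a\<close> forwards
        all that it receives.\<close>
      have "\<exists>t\<ge>t0. 0 < out t a" for t0
      proof -
        obtain t where t: "t \<ge> max t0 T" "0 < inn t a" using ab(4) by blast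
        then have "0 < out t a" using no_cancel[of t a] ab(1) by (simp add: out_eq)
        then show ?thesis using t by auto
      qed
      then show "\<forall>t0. \<exists>t\<ge>t0. 0 < inn t b"
        using visit_propagates[OF ab(1-3)] by blast
    qed
    then obtain t where "t \<ge> T" "0 < inn t i" by blast
    then show False using no_cancel[of t i] T[of t i] lt i by auto
  qed
  then show ?thesis using T by (intro exI[of _ T]) metis
qed

end

section \<open>Clocks\<close>

locale clocks = net +
  fixes src :: "nat \<Rightarrow> nat \<Rightarrow> bool" and D :: "nat \<Rightarrow> nat \<Rightarrow> nat"
  assumes D_0: "\<And>i. i < n \<Longrightarrow> D 0 i = 0"
    and D_Suc: "\<And>t i. i < n \<Longrightarrow> D (Suc t) i =
      (if src t i \<or> (\<exists>j<n. E i j \<and> D t j < D t i) then D t i else Suc (D t i))"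
begin

text \<open>A clock ahead of a neighbour waits, and one that is not ahead gets ahead by one tick
  only.\<close>

lemma D_near: "i < n \<Longrightarrow> j < n \<Longrightarrow> E i j \<Longrightarrow> D t j \<le> Suc (D t i)"
proof (induction t arbitrary: i j)
  case (Suc t)
  have "D t j \<le> Suc (D t i)" "D t i \<le> Suc (D t j)"
    using Suc E_sym by blast+
  moreover have "D (Suc t) j = D t j" if "D t i < D t j"
    using D_Suc[of j t] that Suc.prems E_sym by auto
  moreover have "D t i \<le> D (Suc t) i" "D (Suc t) j \<le> Suc (D t j)"
    using D_Suc Suc.prems by auto
  ultimately show ?case by (cases "D t i < D t j") auto
qed (simp add: D_0)

lemma D_Suc_bounds: "i < n \<Longrightarrow> D t i \<le> D (Suc t) i \<and> D (Suc t) i \<le> Suc (D t i)"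
  by (auto simp: D_Suc)

text \<open>A permanent source has a bounded clock, and boundedness spreads along edges by
  \<open>D_near\<close>; a bounded nondecreasing clock is eventually constant.\<close>

lemma clocks_stop:
  assumes "s < n" "\<forall>t\<ge>T. src t s"
  shows "\<exists>T. \<forall>t\<ge>T. \<forall>i<n. D (Suc t) i = D t i"
proof (rule eventually_all_less)
  fix i assume i: "i < n"
  have "\<exists>B. \<forall>t. D t i \<le> B"
  proof (rule connected_induct[OF assms(1) i])
    have "D t s \<le> D T s" for t
    proof (cases "t \<ge> T")
      case True
      then show ?thesis
        by (induction t rule: dec_induct) (use assms D_Suc[of s] in auto)
    next
      case False
      then show ?thesis
        using lift_Suc_mono_le[of "\<lambda>t. D t s" t T] D_Suc_bounds[OF assms(1)] by auto
    qed
    then show "\<exists>B. \<forall>t. D t s \<le> B" by blast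
  next
    fix a b assume ab: "a < n" "b < n" "E a b" "\<exists>B. \<forall>t. D t a \<le> B"
    then obtain B where "\<forall>t. D t a \<le> B" by blast
    then have "\<forall>t. D t b \<le> Suc B" using D_near[OF ab(1-3)] by (meson Suc_le_mono order_trans)
    then show "\<exists>B. \<forall>t. D t b \<le> B" by blast
  qed
  then obtain B where "\<And>t. D t i \<le> B" by blast
  then show "\<exists>T. \<forall>t\<ge>T. D (Suc t) i = D t i"
    using eventually_stationary_nat[of "\<lambda>t. D t i" B] D_Suc_bounds[OF i] by blast
qed

text \<open>Without sources the slowest clock ticks at every step, so the deficit \<open>t - D t i\<close> of each
  clock is bounded; it is also nondecreasing, hence eventually constant.\<close>

lemma clocks_tick:
  assumes nosrc: "\<forall>t\<ge>T. \<forall>i<n. \<not> src t i"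
  shows "\<exists>T. \<forall>t\<ge>T. \<forall>i<n. D (Suc t) i = Suc (D t i)"
proof (rule eventually_all_less)
  fix i assume i: "i < n"
  have D_le: "D t i \<le> t" if "i < n" for t i
  proof (induction t)
    case (Suc t)
    then show ?case using D_Suc_bounds[OF that, of t] by linarith
  qed (simp add: D_0 that)
  have low: "\<forall>i<n. t \<le> D t i + T" if "t \<ge> T" for t
    using that
  proof (induction t rule: dec_induct)
    case (step t)
    show ?case
    proof (intro allI impI)
      fix i assume i: "i < n"
      show "Suc t \<le> D (Suc t) i + T"
      proof (cases "\<exists>j<n. E i j \<and> D t j < D t i")
        case True
        \<comment> \<open>A clock that waits is ahead of some \<open>j\<close> that obeys the bound,
          so it can afford to lose one step.\<close>
        then obtain j where "j < n" "D t j < D t i" by blast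
        then have "Suc t \<le> D t i + T" using step.IH by fastforce
        then show ?thesis using D_Suc_bounds[OF i, of t] by simp
      next
        case False
        then have "D (Suc t) i = Suc (D t i)"
          using D_Suc[OF i, of t] nosrc i step by auto
        then show ?thesis using step.IH i by auto
      qed
    qed
  qed simp
  have "t - D t i \<le> Suc t - D (Suc t) i" for t
    using D_Suc_bounds[OF i, of t] by arith
  moreover have "t - D t i \<le> T" for t
    using low[of t] i by (cases "t \<ge> T") (auto simp: le_diff_conv add.commute)
  ultimately obtain T' where T': "\<forall>t\<ge>T'. Suc t - D (Suc t) i = t - D t i"
    using eventually_stationary_nat[of "\<lambda>t. t - D t i" T] by blast
  have "D (Suc t) i = Suc (D t i)" if "t \<ge> T'" for t
    using T'[rule_format, OF that] D_le[OF i, of t] D_le[OF i, of "Suc t"] by linarith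
  then show "\<exists>T. \<forall>t\<ge>T. D (Suc t) i = Suc (D t i)" by blast
qed

end

section \<open>The automaton for one weight\<close>

text \<open>In \<open>unit_step W v d first (c, r, D) \<mu>\<close>, the node has weight \<open>v\<close>: it emits \<open>nat v\<close> tokens in the
  first step and can absorb \<open>nat (-v)\<close> tokens, of which it has absorbed \<open>c\<close> so far; \<open>r\<close> is its rotor
  and \<open>D\<close> its clock modulo 3. The Boolean result says that the clock did not tick. The truncation
  to \<open>W\<close> is never active in an execution; it makes the message set closed under arbitrary inputs.\<close>

definition unit_step :: "nat \<Rightarrow> int \<Rightarrow> nat \<Rightarrow> bool \<Rightarrow> nat \<times> nat \<times> nat \<Rightarrow> (nat \<Rightarrow> nat \<times> nat)
    \<Rightarrow> (nat \<times> nat \<times> nat) \<times> bool \<times> (nat \<Rightarrow> nat \<times> nat)" where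
  "unit_step W v d first s \<mu> = (case s of (c, r, D) \<Rightarrow>
     let a = (\<Sum>k=1..d. fst (\<mu> k)) + (if first then nat v else 0);
         q = min a (nat (- v) - c);
         wait = (c < nat (- v) \<or> (\<exists>k\<in>{1..d}. Suc (snd (\<mu> k)) mod 3 = D));
         D' = (if wait then D else Suc D mod 3)
     in ((c + q, if d = 0 then 0 else (r + (a - q)) mod d, D'), wait,
         \<lambda>p. (min W (round_robin d r (a - q) p), D')))"

primrec unit_run :: "nat \<Rightarrow> (nat \<Rightarrow> int) \<Rightarrow> nat \<Rightarrow> (nat \<Rightarrow> nat \<Rightarrow> bool) \<Rightarrow> (nat \<Rightarrow> nat \<Rightarrow> nat)
    \<Rightarrow> nat \<Rightarrow> nat \<Rightarrow> (nat \<times> nat \<times> nat) \<times> bool \<times> (nat \<Rightarrow> nat \<times> nat)" where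
  "unit_run W v n E l 0 = (\<lambda>i. ((0, 0, 0), False, \<lambda>_. (0, 0)))"
| "unit_run W v n E l (Suc t) = (\<lambda>i.
     unit_step W (v i) (deg n E i) (t = 0) (fst (unit_run W v n E l t i))
       (\<lambda>k. if 1 \<le> k \<and> k \<le> deg n E i
            then snd (snd (unit_run W v n E l t (nbr n E l i k))) (l (nbr n E l i k) i)
            else (0, 0)))"

text \<open>The unbounded clock, which no node stores; it serves to analyse the stored
  residues.\<close>

primrec clock :: "nat \<Rightarrow> (nat \<Rightarrow> nat \<Rightarrow> bool) \<Rightarrow> (nat \<Rightarrow> nat \<Rightarrow> bool) \<Rightarrow> nat \<Rightarrow> nat \<Rightarrow> nat" where
  "clock n E src 0 = (\<lambda>i. 0)"
| "clock n E src (Suc t) = (\<lambda>i.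
     if src t i \<or> (\<exists>j<n. E i j \<and> clock n E src t j < clock n E src t i)
     then clock n E src t i else Suc (clock n E src t i))"

text \<open>The possible differences -1, 0 and 1 are distinct modulo 3.\<close>

lemma less_iff_mod_3:
  fixes a b :: nat
  assumes "a \<le> Suc b" "b \<le> Suc a"
  shows "Suc (a mod 3) mod 3 = b mod 3 \<longleftrightarrow> a < b"
proof -
  consider "b = a" | "b = Suc a" | "a = Suc b" using assms by linarith
  then show ?thesis by cases (auto simp: mod_Suc split: if_splits)
qed

text \<open>The state components form a token walk, and the stored clocks are residues of the
  unbounded \<open>clock\<close>. A persisting source eventually makes every node wait forever;
  without sources eventually none waits.\<close>

lemma unit_run_decides_sign:
  assumes network: "network n E l" and W: "\<And>i. i < n \<Longrightarrow> nat (v i) \<le> W"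
  shows "\<exists>T. \<forall>t\<ge>T. \<forall>i<n. fst (snd (unit_run W v n E l t i)) \<longleftrightarrow> (\<Sum>i<n. v i) < 0"
proof -
  interpret net n E l by unfold_locales (rule network)
  define R where "R = unit_run W v n E l"
  define c where "c t i = fst (fst (R t i))" for t i
  define r where "r t i = fst (snd (fst (R t i)))" for t i
  define tok where "tok t i p = fst (snd (snd (R t i)) p)" for t i p
  define inn where "inn t i = (\<Sum>k=1..dg i. tok t (nb i k) (l (nb i k) i)) +
    (if t = 0 then nat (v i) else 0)" for t i
  define out where "out t i = inn t i - min (inn t i) (nat (- v i) - c t i)" for t i
  define src where "src t i \<longleftrightarrow> c t i < nat (- v i)" for t i
  define D where "D = clock n E src"
  have R_Suc: "R (Suc t) i = unit_step W (v i) (dg i) (t = 0) (fst (R t i))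
      (\<lambda>k. if 1 \<le> k \<and> k \<le> dg i then snd (snd (R t (nb i k))) (l (nb i k) i) else (0, 0))" for t i
    unfolding R_def by simp
  interpret token_walk n E l "\<lambda>i. nat (v i)" "\<lambda>i. nat (- v i)" W c r inn out tok
  proof
    show "nat (v i) \<le> W" if "i < n" for i using W that .
    show "inn t i = (\<Sum>k=1..dg i. tok t (nb i k) (l (nb i k) i)) + (if t = 0 then nat (v i) else 0)"
      for t i by (rule inn_def)
    show "out t i = inn t i - min (inn t i) (nat (- v i) - c t i)" for t i by (rule out_def)
    show "c 0 i = 0" "r 0 i = 0" "tok 0 i p = 0" for i p
      by (simp_all add: c_def r_def tok_def R_def)
    have inn: "(\<Sum>k=1..dg i. fst (if 1 \<le> k \<and> k \<le> dg i then snd (snd (R t (nb i k))) (l (nb i k) i)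
        else (0, 0))) + (if t = 0 then nat (v i) else 0) = inn t i" for t i
      unfolding inn_def tok_def by (intro arg_cong2[where f = "(+)"] sum.cong) auto
    have step: "R (Suc t) i = (let
         wait = (c t i < nat (- v i) \<or> (\<exists>k\<in>{1..dg i}. Suc (snd (if 1 \<le> k \<and> k \<le> dg i
           then snd (snd (R t (nb i k))) (l (nb i k) i) else (0, 0))) mod 3 = snd (snd (fst (R t i)))));
         D' = (if wait then snd (snd (fst (R t i))) else Suc (snd (snd (fst (R t i)))) mod 3)
       in ((c t i + min (inn t i) (nat (- v i) - c t i),
            if dg i = 0 then 0 else (r t i + out t i) mod dg i, D'), wait,
           \<lambda>p. (min W (round_robin (dg i) (r t i) (out t i) p), D')))" for t i
      unfolding R_Suc unit_step_def inn out_def c_def r_def Let_def by (simp split: prod.split)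
    show "c (Suc t) i = c t i + min (inn t i) (nat (- v i) - c t i)" for t i
      unfolding c_def[of "Suc t"] step by (simp add: Let_def)
    show "r (Suc t) i = (r t i + out t i) mod dg i" if "0 < dg i" for t i
      unfolding r_def[of "Suc t"] step using that by (simp add: Let_def)
    show "tok (Suc t) i p = min W (round_robin (dg i) (r t i) (out t i) p)" for t i p
      unfolding tok_def[of "Suc t"] step by (simp add: Let_def)
  qed
  interpret clocks n E l src D
    by unfold_locales (auto simp: D_def)
  \<comment> \<open>By \<open>D_near\<close>, the residues seen at the ports tell whether a
    neighbour is behind.\<close>
  have behind: "(\<exists>k\<in>{1..dg i}. Suc (D t (nb i k) mod 3) mod 3 = D t i mod 3) \<longleftrightarrow>
      (\<exists>j<n. E i j \<and> D t j < D t i)" if i: "i < n" for t i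
  proof -
    have *: "Suc (D t j mod 3) mod 3 = D t i mod 3 \<longleftrightarrow> D t j < D t i" if "j < n" "E i j" for j
      using D_near[of i j t] D_near[of j i t] E_sym[of i j] i that by (intro less_iff_mod_3) auto
    show ?thesis
    proof
      assume "\<exists>k\<in>{1..dg i}. Suc (D t (nb i k) mod 3) mod 3 = D t i mod 3"
      then obtain k where k: "k \<in> {1..dg i}" "Suc (D t (nb i k) mod 3) mod 3 = D t i mod 3" by blast
      then show "\<exists>j<n. E i j \<and> D t j < D t i"
        using nbr_port[OF i k(1)] * by blast
    next
      assume "\<exists>j<n. E i j \<and> D t j < D t i"
      then obtain j where j: "j < n" "E i j" "D t j < D t i" by blast
      then show "\<exists>k\<in>{1..dg i}. Suc (D t (nb i k) mod 3) mod 3 = D t i mod 3"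
        using nbr_l[OF i j(1,2)] * by (intro bexI[of _ "l i j"]) auto
    qed
  qed
  have step: "snd (snd (fst (R (Suc t) i))) = D (Suc t) i mod 3 \<and>
      (\<forall>p. snd (snd (snd (R (Suc t) i)) p) = D (Suc t) i mod 3) \<and>
      (fst (snd (R (Suc t) i)) \<longleftrightarrow> D (Suc t) i = D t i)"
    if i: "i < n" and IH: "\<And>i. i < n \<Longrightarrow> snd (snd (fst (R t i))) = D t i mod 3 \<and>
      (\<forall>p. snd (snd (snd (R t i)) p) = D t i mod 3)" for t i
  proof -
    define wait where "wait \<longleftrightarrow> src t i \<or> (\<exists>k\<in>{1..dg i}. Suc (D t (nb i k) mod 3) mod 3 = D t i mod 3)"
    obtain c' r' where s: "fst (R t i) = (c', r', D t i mod 3)"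
      using IH[OF i] by (metis prod.collapse)
    have "(\<exists>k\<in>{1..dg i}. Suc (snd (if 1 \<le> k \<and> k \<le> dg i
          then snd (snd (R t (nb i k))) (l (nb i k) i) else (0, 0))) mod 3 = D t i mod 3)
        \<longleftrightarrow> (\<exists>k\<in>{1..dg i}. Suc (D t (nb i k) mod 3) mod 3 = D t i mod 3)"
      using IH nbr_port(1)[OF i] by (intro bex_cong) auto
    then have "snd (snd (fst (R (Suc t) i))) = (if wait then D t i mod 3 else Suc (D t i mod 3) mod 3) \<and>
      (\<forall>p. snd (snd (snd (R (Suc t) i)) p) = (if wait then D t i mod 3 else Suc (D t i mod 3) mod 3)) \<and>
      (fst (snd (R (Suc t) i)) \<longleftrightarrow> wait)"
      by (simp only: R_Suc unit_step_def s Let_def prod.case fst_conv snd_conv) (simp add: wait_def src_def c_def s)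
    moreover have "D (Suc t) i = (if wait then D t i else Suc (D t i))"
      unfolding wait_def D_Suc[OF i] behind[OF i] by simp
    ultimately show ?thesis by (simp add: mod_Suc_eq)
  qed
  have R_D: "\<And>i. i < n \<Longrightarrow> snd (snd (fst (R t i))) = D t i mod 3 \<and>
      (\<forall>p. snd (snd (snd (R t i)) p) = D t i mod 3)" for t
  proof (induction t)
    case (Suc t)
    show ?case using step[OF Suc.prems Suc.IH] by blast
  qed (simp add: R_def D_def)
  \<comment> \<open>The flag at time \<open>Suc t\<close> reports on the step from \<open>t\<close>
    to \<open>Suc t\<close>, hence the final shift to \<open>Suc T\<close>.\<close>
  have wait: "fst (snd (R (Suc t) i)) \<longleftrightarrow> D (Suc t) i = D t i" if "i < n" for t i
    using step[OF that R_D] by blast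
  have wsum: "(\<Sum>i<n. v i) = int (\<Sum>i<n. nat (v i)) - int (\<Sum>i<n. nat (- v i))"
    by (simp add: sum_subtractf[symmetric]) (intro sum.cong, auto)
  then have sign: "(\<Sum>i<n. v i) < 0 \<longleftrightarrow> (\<Sum>i<n. nat (v i)) < (\<Sum>i<n. nat (- v i))"
    by linarith
  have "\<exists>T. \<forall>t\<ge>T. \<forall>i<n. fst (snd (R (Suc t) i)) \<longleftrightarrow> (\<Sum>i<n. v i) < 0"
  proof (cases "(\<Sum>i<n. v i) < 0")
    case True
    have ex: "\<exists>i<n. src t i" for t
      using source_persists True sign by (simp add: src_def)
    \<comment> \<open>By pigeonhole some node is a source infinitely often; as \<open>c\<close>
      never decreases, it is one at all times.\<close>
    have "\<exists>s<n. \<forall>t0. \<exists>t\<ge>t0. src t s"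
    proof (rule ccontr)
      assume neg: "\<not> ?thesis"
      have "\<exists>t0. \<forall>t\<ge>t0. \<not> src t j" if "j < n" for j
        using neg that by metis
      then obtain t0 where "\<forall>t\<ge>t0. \<forall>j<n. \<not> src t j"
        using eventually_all_less[of n "\<lambda>j t. \<not> src t j"] by blast
      then show False using ex[of t0] by blast
    qed
    then obtain s where s: "s < n" "\<forall>t0. \<exists>t\<ge>t0. src t s" by blast
    have "src t s" for t
    proof -
      obtain t' where t': "t' \<ge> t" "src t' s" using s by blast
      have "c t s \<le> c t' s"
        by (rule lift_Suc_mono_le[OF _ t'(1)]) (simp add: c_Suc s)
      then show ?thesis using t'(2) by (simp add: src_def)
    qed
    then obtain T where "\<forall>t\<ge>T. \<forall>i<n. D (Suc t) i = D t i" using clocks_stop[OF s(1)] by blast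
    then show ?thesis using wait True by blast
  next
    case False
    then have "\<exists>T. \<forall>t\<ge>T. \<forall>i<n. c t i = nat (- v i)"
      by (intro sources_vanish) (use sign in \<open>auto simp: not_less\<close>)
    then obtain T where "\<forall>t\<ge>T. \<forall>i<n. \<not> src t i" unfolding src_def by (metis less_irrefl)
    then obtain T where "\<forall>t\<ge>T. \<forall>i<n. D (Suc t) i = Suc (D t i)" using clocks_tick by blast
    then show ?thesis using wait False by (intro exI[of _ T]) auto
  qed
  then obtain T where T: "\<And>t i. t \<ge> T \<Longrightarrow> i < n \<Longrightarrow> fst (snd (R (Suc t) i)) \<longleftrightarrow> (\<Sum>i<n. v i) < 0" by blast
  show ?thesis
  proof (intro exI[of _ "Suc T"] allI impI)
    fix t i assume "Suc T \<le> t" "i < n"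
    then show "fst (snd (unit_run W v n E l t i)) \<longleftrightarrow> (\<Sum>i<n. v i) < 0"
      using T[of "t - 1" i] by (cases t) (auto simp: R_def)
  qed
qed

section \<open>Running finitely many automata in parallel\<close>

text \<open>Iterated pairing encodes the zero tuple by 0, so the initial memory and messages decode
  to zero in every component.\<close>

primrec enc :: "nat \<Rightarrow> (nat \<Rightarrow> nat) \<Rightarrow> nat" where
  "enc 0 f = 0"
| "enc (Suc q) f = prod_encode (f 0, enc q (\<lambda>k. f (Suc k)))"

primrec dec :: "nat \<Rightarrow> nat \<Rightarrow> nat" where
  "dec 0 z = fst (prod_decode z)"
| "dec (Suc k) z = dec k (snd (prod_decode z))"

lemma prod_encode_0: "prod_encode (0, 0) = 0"
  by (simp add: prod_encode_def)

lemma prod_decode_0: "prod_decode 0 = (0, 0)"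
  by (metis prod_encode_0 prod_encode_inverse)

lemma dec_0: "dec k 0 = 0"
  by (induction k) (simp_all add: prod_decode_0)

lemma dec_enc: "k < q \<Longrightarrow> dec k (enc q f) = f k"
  by (induction q arbitrary: k f) (auto simp: less_Suc_eq_0_disj)

primrec enc_set :: "nat \<Rightarrow> nat set \<Rightarrow> nat set" where
  "enc_set 0 S = {0}"
| "enc_set (Suc q) S = prod_encode ` (S \<times> enc_set q S)"

lemma enc_in_enc_set: "(\<And>k. k < q \<Longrightarrow> f k \<in> S) \<Longrightarrow> enc q f \<in> enc_set q S"
  by (induction q arbitrary: f) auto

lemma dec_in: "z \<in> enc_set q S \<Longrightarrow> k < q \<Longrightarrow> dec k z \<in> S"
  by (induction q arbitrary: z k) (auto simp: less_Suc_eq_0_disj)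

lemma finite_enc_set: "finite S \<Longrightarrow> finite (enc_set q S)"
  by (induction q) auto

lemma card_enc_set: "card (enc_set q S) = card S ^ q"
  by (induction q) (auto simp: card_image inj_prod_encode card_cartesian_product)

lemma zero_in_enc_set: "0 \<in> S \<Longrightarrow> 0 \<in> enc_set q S"
  by (induction q) (auto simp: prod_encode_0 intro: image_eqI[where x = "(0, 0)"])

definition enc3 :: "nat \<times> nat \<times> nat \<Rightarrow> nat" where
  "enc3 s = prod_encode (fst s, prod_encode (snd s))"

definition dec3 :: "nat \<Rightarrow> nat \<times> nat \<times> nat" where
  "dec3 z = (fst (prod_decode z), prod_decode (snd (prod_decode z)))"

lemma dec3_enc3: "dec3 (enc3 s) = s"
  by (simp add: dec3_def enc3_def)

lemma dec3_0: "dec3 0 = (0, 0, 0)"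
  by (simp add: dec3_def prod_decode_0)

lemma enc3_0: "enc3 (0, 0, 0) = 0"
  by (simp add: enc3_def prod_encode_0)

text \<open>\<open>F\<close> turns the sign pattern into an output. Every step outputs some value,
  so \<open>y = None\<close> marks the first step.\<close>

definition threshold_automaton ::
    "nat \<Rightarrow> nat \<Rightarrow> (nat \<Rightarrow> nat \<Rightarrow> int) \<Rightarrow> ((nat \<Rightarrow> bool) \<Rightarrow> 'y) \<Rightarrow> 'y automaton" where
  "threshold_automaton W q v F d x z y \<mu> =
    (let R = (\<lambda>k. unit_step W (v k x) d (y = None) (dec3 (dec k z)) (\<lambda>p. prod_decode (dec k (\<mu> p))))
     in (enc q (\<lambda>k. enc3 (fst (R k))), Some (F (\<lambda>k. k < q \<and> fst (snd (R k)))),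
         \<lambda>p. enc q (\<lambda>k. prod_encode (snd (snd (R k)) p))))"

lemma run_threshold_automaton:
  fixes W q v n E l x and F :: "(nat \<Rightarrow> bool) \<Rightarrow> 'y"
  defines "A \<equiv> threshold_automaton W q v F"
  defines "R \<equiv> \<lambda>k. unit_run W (\<lambda>i. v k (x i)) n E l"
  shows "(\<forall>k<q. dec3 (dec k (fst (run A n E l x t i))) = fst (R k t i) \<and>
      (\<forall>p. prod_decode (dec k (snd (snd (run A n E l x t i)) p)) = snd (snd (R k t i)) p)) \<and>
    fst (snd (run A n E l x t i)) = (if t = 0 then None else Some (F (\<lambda>k. k < q \<and> fst (snd (R k t i)))))"
proof (induction t arbitrary: i)
  case 0
  show ?case by (simp add: R_def dec_0 prod_decode_0 dec3_0)
next
  case (Suc t)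
  have first: "fst (snd (run A n E l x t i)) = None \<longleftrightarrow> t = 0" using Suc[of i] by simp
  let ?\<mu> = "\<lambda>k. if 1 \<le> k \<and> k \<le> deg n E i
            then snd (snd (run A n E l x t (nbr n E l i k))) (l (nbr n E l i k) i) else 0"
  \<comment> \<open>The default 0 for absent ports decodes to the default \<open>(0, 0)\<close> of
    \<open>unit_run\<close>.\<close>
  have \<mu>: "(\<lambda>p. prod_decode (dec k (?\<mu> p))) = (\<lambda>p. if 1 \<le> p \<and> p \<le> deg n E i
            then snd (snd (R k t (nbr n E l i p))) (l (nbr n E l i p) i)
            else (0, 0))" if "k < q" for k
    using Suc that by (auto simp: fun_eq_iff dec_0 prod_decode_0)
  have step: "unit_step W (v k (x i)) (deg n E i) (fst (snd (run A n E l x t i)) = None)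
      (dec3 (dec k (fst (run A n E l x t i)))) (\<lambda>p. prod_decode (dec k (?\<mu> p))) = R k (Suc t) i"
    if "k < q" for k
    unfolding \<mu>[OF that] first using Suc[of i] that unfolding R_def by simp
  let ?U = "\<lambda>k. unit_step W (v k (x i)) (deg n E i) (fst (snd (run A n E l x t i)) = None)
      (dec3 (dec k (fst (run A n E l x t i)))) (\<lambda>p. prod_decode (dec k (?\<mu> p)))"
  have run: "run A n E l x (Suc t) i = (enc q (\<lambda>k. enc3 (fst (?U k))),
      Some (F (\<lambda>k. k < q \<and> fst (snd (?U k)))), \<lambda>p. enc q (\<lambda>k. prod_encode (snd (snd (?U k)) p)))"
    unfolding A_def run.simps(2) threshold_automaton_def Let_def by (rule refl)
  have "(\<lambda>k. k < q \<and> fst (snd (?U k))) = (\<lambda>k. k < q \<and> fst (snd (R k (Suc t) i)))"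
    using step by (auto simp: fun_eq_iff)
  then show ?case unfolding run using step by (simp add: dec_enc dec3_enc3)
qed

text \<open>The bounds hold for arbitrary messages, by the truncation to \<open>W\<close>, the
  moduli and the remaining capacity.\<close>

lemma unit_step_closed:
  assumes "s \<in> {..W} \<times> {..d} \<times> {..2}" "nat (- v) \<le> W"
  shows "fst (unit_step W v d first s \<mu>) \<in> {..W} \<times> {..d} \<times> {..2}"
    and "snd (snd (unit_step W v d first s \<mu>)) p \<in> {..W} \<times> {..2}"
proof -
  obtain c r D where s: "s = (c, r, D)" "c \<le> W" "D \<le> 2"
    using assms(1) by auto
  have rotor: "(if d = 0 then 0 else m mod d) \<le> d" for m
    by simp
  have tick: "(if wait then D else Suc D mod 3) \<le> 2" for wait
    using s(3) by (cases wait) (simp_all add: less_Suc_eq_le[symmetric] numeral_3_eq_3[symmetric])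
  have absorbed: "c + min a (nat (- v) - c) \<le> W" for a
    using s(2) assms(2) by linarith
  show "fst (unit_step W v d first s \<mu>) \<in> {..W} \<times> {..d} \<times> {..2}"
    unfolding unit_step_def s prod.case Let_def fst_conv
    by (intro SigmaI) (simp_all only: atMost_iff rotor tick absorbed)
  show "snd (snd (unit_step W v d first s \<mu>)) p \<in> {..W} \<times> {..2}"
    unfolding unit_step_def s prod.case Let_def snd_conv
    by (intro SigmaI) (simp_all only: atMost_iff tick min.cobounded1)
qed

text \<open>For degree \<open>d\<close> there are \<open>(Suc W * (Suc d * 3)) ^ q\<close> memory
  states, polynomially many in \<open>d\<close>, so a linear bound on the logarithm is
  generous.\<close>

lemma finite_memory_threshold_automaton:
  fixes F :: "(nat \<Rightarrow> bool) \<Rightarrow> 'y::finite"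
  assumes W: "\<And>k x. k < q \<Longrightarrow> x \<in> {1..K} \<Longrightarrow> nat (- v k x) \<le> W"
  shows "finite_memory K (threshold_automaton W q v F) (enc_set q (prod_encode ` ({..W} \<times> {..2})))
    (\<lambda>d. enc_set q (enc3 ` ({..W} \<times> {..d} \<times> {..2})))"
proof -
  let ?M = "prod_encode ` ({..W} \<times> {..2})"
  let ?S = "\<lambda>d. enc3 ` ({..W} \<times> {..d} \<times> {..2::nat})"
  have zero: "0 \<in> enc_set q ?M" "0 \<in> enc_set q (?S d)" for d
    by (intro zero_in_enc_set image_eqI[of _ _ "(0, 0)"] image_eqI[of _ _ "(0, 0, 0)"];
        simp add: prod_encode_0 enc3_0)+
  have inj: "inj enc3"
    by (rule inj_on_inverseI[where g = dec3]) (rule dec3_enc3)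
  have card: "card (?S d) = Suc W * (Suc d * 3)" for d
    using inj by (simp add: card_image inj_on_subset card_cartesian_product)
  \<comment> \<open>The factor 6 comes from \<open>Suc d * 3 \<le> 6 * d\<close> for
    \<open>d \<ge> 1\<close>, together with \<open>log 2 N \<le> N\<close>.\<close>
  have "log 2 (card (enc_set q (?S d))) \<le> (q * (6 * Suc W)) * real d" if "d \<ge> 1" for d
  proof -
    let ?N = "Suc W * (Suc d * 3)"
    have "log 2 (real ?N) \<le> real ?N"
      by (rule log2_of_power_le) (use less_exp[of ?N] in \<open>simp_all add: less_imp_le\<close>)
    also have "\<dots> \<le> real (6 * Suc W * d)"
    proof (intro of_nat_mono)
      have "Suc W * (Suc d * 3) \<le> Suc W * (6 * d)" using that by (intro mult_le_mono2) simp
      then show "Suc W * (Suc d * 3) \<le> 6 * Suc W * d" by (simp only: ac_simps)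
    qed
    finally have le: "log 2 (real ?N) \<le> real (6 * Suc W * d)" .
    have "log 2 (card (enc_set q (?S d))) = q * log 2 (real ?N)"
      unfolding card_enc_set card of_nat_power by (rule log_nat_power) simp
    also have "\<dots> \<le> q * real (6 * Suc W * d)"
      using le by (intro mult_left_mono) auto
    finally show ?thesis by (simp add: mult.assoc)
  qed
  then have log: "\<exists>C::real. \<forall>d\<ge>1. log 2 (card (enc_set q (?S d))) \<le> C * d"
    by blast
  have closed: "fst (threshold_automaton W q v F d x z y \<mu>) \<in> enc_set q (?S d) \<and>
      snd (snd (threshold_automaton W q v F d x z y \<mu>)) p \<in> enc_set q ?M"
    if "x \<in> {1..K}" "z \<in> enc_set q (?S d)" for d x z y \<mu> p
  proof -
    have "dec3 (dec k z) \<in> {..W} \<times> {..d} \<times> {..2}" if "k < q" for k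
      using dec_in[OF \<open>z \<in> enc_set q (?S d)\<close> that] by (auto simp: dec3_enc3)
    then show ?thesis
      unfolding threshold_automaton_def Let_def fst_conv snd_conv
      using W[OF _ that(1)] by (intro conjI enc_in_enc_set imageI unit_step_closed)
  qed
  show ?thesis
    unfolding finite_memory_def using zero log closed by (auto intro!: finite_enc_set)
qed

section \<open>Halfspaces and integer weights\<close>

lemma common_denominator:
  fixes \<beta> :: "'a \<Rightarrow> rat"
  assumes "finite I"
  shows "\<exists>N::int. 0 < N \<and> (\<forall>i\<in>I. \<exists>z::int. of_int N * \<beta> i = of_int z)"
  using assms
proof induction
  case (insert i I)
  then obtain N :: int where N: "0 < N" "\<forall>i\<in>I. \<exists>z::int. of_int N * \<beta> i = of_int z" by blast
  obtain a b where ab: "quotient_of (\<beta> i) = (a, b)" by fastforce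
  have b: "0 < b" using quotient_of_denom_pos[OF ab] .
  have \<beta>: "\<beta> i = of_int a / of_int b" using quotient_of_div[OF ab] .
  have "\<exists>z::int. of_int (N * b) * \<beta> j = of_int z" if "j \<in> insert i I" for j
  proof (cases "j = i")
    case True
    then have "of_int (N * b) * \<beta> j = of_int (N * a)" using b by (simp add: \<beta>)
    then show ?thesis by blast
  next
    case False
    then obtain z :: int where "of_int N * \<beta> j = of_int z" using N(2) \<open>j \<in> insert i I\<close> by blast
    then have "of_int (N * b) * \<beta> j = of_int (z * b)" by (simp add: mult.commute mult.left_commute)
    then show ?thesis by blast
  qed
  then show ?case using N(1) b by (intro exI[of _ "N * b"]) simp
qed (auto intro: exI[of _ 1])

text \<open>The coordinates sum to 1, so \<open>b\<close> can be subtracted from each coefficient;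
  multiplying by a positive common denominator keeps the sign.\<close>

lemma integer_weights:
  fixes \<alpha> :: "nat \<Rightarrow> rat" and b :: rat
  shows "\<exists>w::nat \<Rightarrow> int. \<forall>p\<in>prop_set K.
    (\<Sum>k=1..K. of_int (w k) * p k) < 0 \<longleftrightarrow> (\<Sum>k=1..K. of_rat (\<alpha> k) * p k) < of_rat b"
proof -
  obtain N :: int where N: "0 < N" "\<forall>k\<in>{1..K}. \<exists>z::int. of_int N * (\<alpha> k - b) = of_int z"
    using common_denominator[of "{1..K}" "\<lambda>k. \<alpha> k - b"] by auto
  then obtain w :: "nat \<Rightarrow> int" where w: "\<forall>k\<in>{1..K}. of_int N * (\<alpha> k - b) = of_int (w k)"
    by metis
  have w_real: "real_of_int (w k) = of_int N * (of_rat (\<alpha> k) - of_rat b)" if "k \<in> {1..K}" for k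
  proof -
    have "(of_rat (of_int (w k)) :: real) = of_rat (of_int N * (\<alpha> k - b))" using w that by simp
    then show ?thesis by (simp add: of_rat_mult of_rat_diff)
  qed
  show ?thesis
  proof (intro exI ballI)
    fix p assume "p \<in> prop_set K"
    then have sum1: "(\<Sum>k=1..K. p k) = 1" by (simp add: prop_set_def)
    have "(\<Sum>k=1..K. of_int (w k) * p k)
        = (\<Sum>k=1..K. of_int N * (of_rat (\<alpha> k) * p k) - of_int N * of_rat b * p k)"
      by (intro sum.cong) (auto simp: w_real algebra_simps)
    also have "\<dots> = of_int N * (\<Sum>k=1..K. of_rat (\<alpha> k) * p k) - of_int N * of_rat b * (\<Sum>k=1..K. p k)"
      by (simp only: sum_subtractf sum_distrib_left)
    also have "\<dots> = of_int N * ((\<Sum>k=1..K. of_rat (\<alpha> k) * p k) - of_rat b)"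
      unfolding sum1 by (simp only: right_diff_distrib mult_1_right)
    finally show "(\<Sum>k=1..K. of_int (w k) * p k) < 0 \<longleftrightarrow> (\<Sum>k=1..K. of_rat (\<alpha> k) * p k) < of_rat b"
      using N(1) by (simp add: mult_less_0_iff)
  qed
qed

text \<open>That the sign determines membership covers both kinds at once: a strict halfspace is a
  sign condition, a non-strict one the negation of the sign condition with opposite
  coefficients.\<close>

lemma halfspace_weights:
  "\<exists>w::nat \<Rightarrow> int. \<forall>p\<in>prop_set K. \<forall>p'\<in>prop_set K.
    ((\<Sum>k=1..K. of_int (w k) * p k) < 0 \<longleftrightarrow> (\<Sum>k=1..K. of_int (w k) * p' k) < 0) \<longrightarrow>
    (p \<in> halfspace K c \<longleftrightarrow> p' \<in> halfspace K c)"
proof -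
  obtain \<alpha> b strict where c: "c = (\<alpha>, b, strict)" by (cases c)
  show ?thesis
  proof (cases strict)
    case True
    obtain w :: "nat \<Rightarrow> int" where "\<forall>p\<in>prop_set K.
        (\<Sum>k=1..K. of_int (w k) * p k) < 0 \<longleftrightarrow> (\<Sum>k=1..K. of_rat (\<alpha> k) * p k) < of_rat b"
      using integer_weights[of K \<alpha> b] by blast
    then show ?thesis using True by (intro exI[of _ w]) (simp add: halfspace_def c)
  next
    case False
    obtain w :: "nat \<Rightarrow> int" where "\<forall>p\<in>prop_set K.
        (\<Sum>k=1..K. of_int (w k) * p k) < 0 \<longleftrightarrow> (\<Sum>k=1..K. of_rat (- \<alpha> k) * p k) < of_rat (- b)"
      using integer_weights[of K "\<lambda>k. - \<alpha> k" "- b"] by blast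
    then have "\<forall>p\<in>prop_set K.
        (\<Sum>k=1..K. of_int (w k) * p k) < 0 \<longleftrightarrow> \<not> (\<Sum>k=1..K. of_rat (\<alpha> k) * p k) \<le> of_rat b"
      by (simp add: of_rat_minus sum_negf not_le)
    then show ?thesis using False by (intro exI[of _ w]) (simp add: halfspace_def c)
  qed
qed

lemma proportions_in_prop_set:
  assumes "0 < n" "\<forall>i<n. x i \<in> {1..K}"
  shows "proportions n x \<in> prop_set K"
proof -
  have "card {i. i < n \<and> x i = k} \<le> n" for k
    using card_mono[of "{..<n}" "{i. i < n \<and> x i = k}"] by auto
  moreover have "(\<Sum>k=1..K. card {i. i < n \<and> x i = k}) = n"
    using sum.group[of "{..<n}" "{1..K}" x "\<lambda>_. 1::nat"] assms(2) by (auto simp: image_subset_iff)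
  then have "(\<Sum>k=1..K. real (card {i. i < n \<and> x i = k})) = real n"
    by (metis of_nat_sum)
  moreover have "{i. i < n \<and> x i = k} = {}" if "k \<notin> {1..K}" for k
    using assms(2) that by blast
  ultimately show ?thesis
    using assms(1) by (auto simp: prop_set_def proportions_def sum_divide_distrib[symmetric])
qed

text \<open>Grouping the nodes by initial value turns the linear form into an average over the
  nodes, whose sign the network decides.\<close>

lemma weighted_proportions:
  assumes "\<forall>i<n. x i \<in> {1..K}"
  shows "(\<Sum>k=1..K. of_int (w k) * proportions n x k) = of_int (\<Sum>i<n. w (x i)) / real n"
proof -
  have "(\<Sum>i<n. real_of_int (w (x i)))
      = (\<Sum>k=1..K. \<Sum>i\<in>{i \<in> {..<n}. x i = k}. real_of_int (w (x i)))"
    using assms by (intro sum.group[symmetric]) auto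
  also have "\<dots> = (\<Sum>k=1..K. of_int (w k) * real (card {i. i < n \<and> x i = k}))"
    by (intro sum.cong) auto
  finally show ?thesis
    by (simp add: proportions_def sum_divide_distrib)
qed

section \<open>Recovering \<open>h\<close> from the sign pattern\<close>

theorem theorem3:
  fixes K :: nat and h :: "(nat \<Rightarrow> real) \<Rightarrow> 'y::finite"
  assumes "\<forall>y. \<exists>F :: ((nat \<Rightarrow> rat) \<times> rat \<times> bool) set set.
             finite F \<and> (\<forall>S\<in>F. finite S) \<and>
             {p \<in> prop_set K. h p = y} = (\<Union>S\<in>F. prop_set K \<inter> (\<Inter>c\<in>S. halfspace K c))"
  shows "computable_prop K h"
proof -
  obtain \<F> :: "'y \<Rightarrow> ((nat \<Rightarrow> rat) \<times> rat \<times> bool) set set" where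
    \<F>: "\<forall>y. finite (\<F> y) \<and> (\<forall>S\<in>\<F> y. finite S) \<and>
      {p \<in> prop_set K. h p = y} = (\<Union>S\<in>\<F> y. prop_set K \<inter> (\<Inter>c\<in>S. halfspace K c))"
    using choice[OF assms] by (rule exE)
  have level: "{p \<in> prop_set K. h p = y} = (\<Union>S\<in>\<F> y. prop_set K \<inter> (\<Inter>c\<in>S. halfspace K c))" for y
    using \<F> by (elim allE conjE)
  \<comment> \<open>There are finitely many outputs, so finitely many halfspaces describe all level
    sets; \<open>e\<close> lists them.\<close>
  have "finite (\<Union>y. \<Union>(\<F> y))"
    using \<F> by (intro finite_UN_I finite_Union) simp_all
  then obtain q and e :: "nat \<Rightarrow> (nat \<Rightarrow> rat) \<times> rat \<times> bool" where e: "(\<Union>y. \<Union>(\<F> y)) = e ` {i. i < q}"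
    using finite_imp_nat_seg_image_inj_on by metis
  have "\<exists>v. \<forall>k. \<forall>p\<in>prop_set K. \<forall>p'\<in>prop_set K.
      ((\<Sum>j=1..K. of_int (v k j) * p j) < 0 \<longleftrightarrow> (\<Sum>j=1..K. of_int (v k j) * p' j) < 0) \<longrightarrow>
      (p \<in> halfspace K (e k) \<longleftrightarrow> p' \<in> halfspace K (e k))"
    using halfspace_weights by (intro choice allI)
  then obtain v :: "nat \<Rightarrow> nat \<Rightarrow> int" where v: "\<And>k p p'. p \<in> prop_set K \<Longrightarrow> p' \<in> prop_set K \<Longrightarrow>
      ((\<Sum>j=1..K. of_int (v k j) * p j) < 0 \<longleftrightarrow> (\<Sum>j=1..K. of_int (v k j) * p' j) < 0) \<Longrightarrow>
      (p \<in> halfspace K (e k) \<longleftrightarrow> p' \<in> halfspace K (e k))"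
    by blast
  define sat where "sat k p \<longleftrightarrow> (\<Sum>j=1..K. of_int (v k j) * p j) < (0::real)" for k and p :: "nat \<Rightarrow> real"
  \<comment> \<open>Some intersection \<open>S\<close> containing \<open>p\<close> lies in the level
    set of \<open>h p\<close>. Membership in its halfspaces depends on the signs only, so it
    contains \<open>p'\<close> too.\<close>
  have determined: "h p = h p'"
    if p: "p \<in> prop_set K" "p' \<in> prop_set K" and eq: "\<forall>k<q. sat k p' \<longleftrightarrow> sat k p" for p p'
  proof -
    have "p \<in> {p \<in> prop_set K. h p = h p}" using p by simp
    then obtain S where S: "S \<in> \<F> (h p)" "\<forall>c\<in>S. p \<in> halfspace K c"
      using level[of "h p"] p(1) by blast
    have "p' \<in> halfspace K c" if "c \<in> S" for c
    proof -
      have "c \<in> e ` {i. i < q}" using S(1) that e by blast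
      then obtain k where "k < q" "c = e k" by blast
      then show ?thesis using v[OF p, of k] eq S(2) that by (simp add: sat_def)
    qed
    then have "p' \<in> {p' \<in> prop_set K. h p' = h p}" unfolding level using S(1) p(2) by blast
    then show ?thesis by simp
  qed
  \<comment> \<open>Any point with pattern \<open>b\<close> will do, by \<open>determined\<close>;
    for a pattern without points the value is arbitrary.\<close>
  define F where "F b = h (SOME p. p \<in> prop_set K \<and> (\<forall>k<q. b k \<longleftrightarrow> sat k p))" for b
  have F: "F b = h p" if "p \<in> prop_set K" "\<And>k. k < q \<Longrightarrow> b k \<longleftrightarrow> sat k p" for b p
  proof -
    let ?P = "\<lambda>p. p \<in> prop_set K \<and> (\<forall>k<q. b k \<longleftrightarrow> sat k p)"
    define p' where "p' = (SOME p. ?P p)"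
    have "?P p'" unfolding p'_def using that by (intro someI[of ?P p]) simp
    then have "h p' = h p" using that by (intro determined) auto
    then show ?thesis by (simp only: F_def p'_def)
  qed
  \<comment> \<open>One bound for all weights in absolute value, hence for emissions and
    capacities.\<close>
  define W where "W = (\<Sum>k<q. \<Sum>j=1..K. nat \<bar>v k j\<bar>)"
  have W: "nat \<bar>v k j\<bar> \<le> W" if "k < q" "j \<in> {1..K}" for k j
  proof -
    have "nat \<bar>v k j\<bar> \<le> (\<Sum>j=1..K. nat \<bar>v k j\<bar>)" by (rule member_le_sum) (use that in auto)
    also have "\<dots> \<le> W" unfolding W_def by (rule member_le_sum) (use that in auto)
    finally show ?thesis .
  qed
  let ?A = "threshold_automaton W q v F"
  have "final_output ?A n E l x (Some (h (proportions n x)))"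
    if net: "network n E l" and x: "\<forall>i<n. x i \<in> {1..K}" for n E l x
  proof -
    have n: "0 < n" using net by (simp add: network_def)
    have sat: "(\<Sum>i<n. v k (x i)) < 0 \<longleftrightarrow> sat k (proportions n x)" for k
      unfolding sat_def weighted_proportions[OF x] using n
      by (simp only: divide_less_0_iff) (simp del: of_int_sum)
    let ?R = "\<lambda>k. unit_run W (\<lambda>i. v k (x i)) n E l"
    have "\<exists>T. \<forall>t\<ge>T. \<forall>i<n. fst (snd (?R k t i)) \<longleftrightarrow> (\<Sum>i<n. v k (x i)) < 0" if "k < q" for k
    proof (rule unit_run_decides_sign[OF net])
      show "nat (v k (x i)) \<le> W" if "i < n" for i
        using W[OF \<open>k < q\<close>, of "x i"] x that by auto
    qed
    then obtain T where T: "\<forall>t\<ge>T. \<forall>k<q. \<forall>i<n. fst (snd (?R k t i)) \<longleftrightarrow> sat k (proportions n x)"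
      using eventually_all_less[of q "\<lambda>k t. \<forall>i<n. fst (snd (?R k t i)) \<longleftrightarrow> sat k (proportions n x)"]
      unfolding sat by blast
    \<comment> \<open>\<open>Suc T\<close> excludes time 0, at which the output is still
      \<open>None\<close>.\<close>
    have "fst (snd (run ?A n E l x t i)) = Some (h (proportions n x))" if "Suc T \<le> t" "i < n" for t i
    proof -
      have "F (\<lambda>k. k < q \<and> fst (snd (?R k t i))) = h (proportions n x)"
        using T that by (intro F proportions_in_prop_set n x) auto
      then show ?thesis using run_threshold_automaton[of q W v F n E l x t i] that by simp
    qed
    then show ?thesis unfolding final_output_def by blast
  qed
  moreover have "finite_memory K ?A (enc_set q (prod_encode ` ({..W} \<times> {..2})))
      (\<lambda>d. enc_set q (enc3 ` ({..W} \<times> {..d} \<times> {..2})))"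
    by (rule finite_memory_threshold_automaton) (use W in fastforce)
  ultimately show ?thesis
    unfolding computable_prop_def computable_family_def by blast
qed

end
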